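(* Suppose $M$ is a thin merge tree. Then there is a star graph $S_n$ and a critical discrete Morse function $f\colon S_n\to\mathbb{R}$ such that $M_f=M$, where $M_f$ is the merge tree induced by $f$ (equality meaning equality as unlabeled binary trees, i.e. there is a rooted tree isomorphism $M_f\to M$ preserving left and right children).
   Context: Graphs are finite and simple; a \emph{simplex} of a graph is a vertex or an edge. A star graph is a complete bipartite graph $K_{1,k}$ with $k\ge 1$. A function $f$ from the set of simplices of a graph $G$ to $\mathbb{R}$ (written $f\colon G\to\mathbb{R}$) is a \emph{discrete Morse function} if (i) $f(v)\le f(e)$ whenever $v$ is an endpoint of the edge $e$; (ii) $f$ is at most 2--1 (each value is taken by at most two simplices); (iii) if $f(\sigma)=f(\tau)$ then $\sigma\subseteq\tau$ or $\tau\subseteq\sigma$. A simplex $\sigma$ is \emph{critical} if no other simplex has the value $f(\sigma)$. A discrete Morse function is called \emph{critical} if every simplex is critical, i.e. $f$ is injective. A \emph{binary tree} is a (finite) rooted tree in which each vertex has at most two children, each child being designated as the left (L) or the right (R) child, with at most one of each. It is \emph{full} if every vertex has $0$ or $2$ children. A \emph{merge tree} is a full binary tree. Its vertices are called nodes. A node with exactly one neighbor is a \emph{leaf}; a node with more than one neighbor is an \emph{internal node}. An internal node adjacent to exactly two leaves is an \emph{impasse}. A merge tree is \emph{thin} if it has exactly one impasse. Construction of $M_f$ for a critical discrete Morse function $f$ on a tree $T$ with at least one edge. For a value $c$ of $f$ let $T_{c-\epsilon}$ be the subgraph of $T$ consisting of all simplices $\sigma$ with $f(\sigma)<c$, and for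 a vertex $w$ of it let $T_{c-\epsilon}[w]$ be the connected component containing $w$. Each node $x$ of $M_f$ carries a real label $f_M(x)$, which is a value of $f$, and a direction L or R. (1) Start with a root node, labeled by the largest value of $f$ (which is attained on an edge), with direction L. (2) Whenever a node $x$ has label $c=f(uv)$ for an edge $uv$ of $T$, create two children $n_u,n_v$ of $x$ with labels $f_M(n_u)=\max\{f(\sigma):\sigma\in T_{c-\epsilon}[u]\}$ and $f_M(n_v)=\max\{f(\sigma):\sigma\in T_{c-\epsilon}[v]\}$. If $\min\{f(\sigma):\sigma\in T_{c-\epsilon}[u]\}<\min\{f(\sigma):\sigma\in T_{c-\epsilon}[v]\}$, give $n_u$ the same direction as $x$ and $n_v$ the opposite direction; if the reverse inequality holds, give $n_v$ the same direction as $x$ and $n_u$ the opposite direction. The child with direction L is the left child and the child with direction R is the right child. (3) A node whose label is the value of a vertex gets no children. Continue until all nodes labeled by edges have been given children. *)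

theory Defs
  imports Complex_Main "HOL-Library.Tree"
begin

section \<open>Graphs and discrete Morse functions\<close>

record 'a graph =
  verts :: "'a set"
  edges :: "'a set set"

definition simple_graph :: "'a graph \<Rightarrow> bool" where
  "simple_graph G \<longleftrightarrow> finite (verts G) \<and> (\<forall>e\<in>edges G. e \<subseteq> verts G \<and> card e = 2)"

text \<open>A vertex \<open>v\<close> is identified with the simplex \<open>{v}\<close>, an edge with the set of its
  endpoints, so that the face relation is \<open>\<subseteq>\<close>.\<close>

definition simplices :: "'a graph \<Rightarrow> 'a set set" where
  "simplices G = (\<lambda>v. {v}) ` verts G \<union> edges G"

definition complete_bipartite :: "nat \<Rightarrow> nat \<Rightarrow> 'a graph \<Rightarrow> bool" where
  "complete_bipartite m n G \<longleftrightarrow>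
    (\<exists>A B. finite A \<and> finite B \<and> A \<inter> B = {} \<and> card A = m \<and> card B = n \<and>
       verts G = A \<union> B \<and> edges G = {{a, b} | a b. a \<in> A \<and> b \<in> B})"

definition star_graph :: "'a graph \<Rightarrow> bool" where
  "star_graph G \<longleftrightarrow> (\<exists>k\<ge>1. complete_bipartite 1 k G)"

text \<open>Functions on simplices are total functions on sets; only their values on
  \<^term>\<open>simplices G\<close> matter.\<close>

definition discrete_morse :: "'a graph \<Rightarrow> ('a set \<Rightarrow> real) \<Rightarrow> bool" where
  "discrete_morse G f \<longleftrightarrow>
    (\<forall>e\<in>edges G. \<forall>v\<in>e. f {v} \<le> f e) \<and>
    (\<forall>y. card {\<sigma> \<in> simplices G. f \<sigma> = y} \<le> 2) \<and>
    (\<forall>\<sigma>\<in>simplices G. \<forall>\<tau>\<in>simplices G. f \<sigma> = f \<tau> \<longrightarrow> \<sigma> \<subseteq> \<tau> \<or> \<tau> \<subseteq> \<sigma>)"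

definition critical_simplex :: "'a graph \<Rightarrow> ('a set \<Rightarrow> real) \<Rightarrow> 'a set \<Rightarrow> bool" where
  "critical_simplex G f \<sigma> \<longleftrightarrow>
    \<sigma> \<in> simplices G \<and> (\<forall>\<tau>\<in>simplices G. \<tau> \<noteq> \<sigma> \<longrightarrow> f \<tau> \<noteq> f \<sigma>)"

definition critical_discrete_morse :: "'a graph \<Rightarrow> ('a set \<Rightarrow> real) \<Rightarrow> bool" where
  "critical_discrete_morse G f \<longleftrightarrow>
    discrete_morse G f \<and> (\<forall>\<sigma>\<in>simplices G. critical_simplex G f \<sigma>)"

section \<open>Binary trees\<close>

text \<open>In the library type \<^typ>\<open>'a tree\<close> the constructor \<^const>\<open>Leaf\<close> is the empty tree. It
  encodes an absent child, so a vertex without children is \<open>Node Leaf x Leaf\<close>. A vertex is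
  addressed by the list of directions leading to it from the root.\<close>

type_synonym binary_tree = "unit tree"

definition unlabeled :: "'a tree \<Rightarrow> binary_tree" where
  "unlabeled t = map_tree (\<lambda>_. ()) t"

datatype direction = L | R

fun opposite :: "direction \<Rightarrow> direction" where
  "opposite L = R"
| "opposite R = L"

fun nodes_of :: "'a tree \<Rightarrow> direction list set" where
  "nodes_of Leaf = {}"
| "nodes_of (Node l x r) = insert [] ((#) L ` nodes_of l \<union> (#) R ` nodes_of r)"

definition children :: "'a tree \<Rightarrow> direction list \<Rightarrow> direction list set" where
  "children t p = {q \<in> nodes_of t. \<exists>d. q = p @ [d]}"

definition neighbors :: "'a tree \<Rightarrow> direction list \<Rightarrow> direction list set" where
  "neighbors t p = {q \<in> nodes_of t. q \<in> children t p \<or> p \<in> children t q}"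

definition full :: "'a tree \<Rightarrow> bool" where
  "full t \<longleftrightarrow> (\<forall>p\<in>nodes_of t. card (children t p) = 0 \<or> card (children t p) = 2)"

definition merge_tree :: "'a tree \<Rightarrow> bool" where
  "merge_tree t \<longleftrightarrow> t \<noteq> Leaf \<and> full t"

definition leaf_node :: "'a tree \<Rightarrow> direction list \<Rightarrow> bool" where
  "leaf_node t p \<longleftrightarrow> p \<in> nodes_of t \<and> card (neighbors t p) = 1"

definition internal_node :: "'a tree \<Rightarrow> direction list \<Rightarrow> bool" where
  "internal_node t p \<longleftrightarrow> p \<in> nodes_of t \<and> card (neighbors t p) > 1"

definition impasse :: "'a tree \<Rightarrow> direction list \<Rightarrow> bool" where
  "impasse t p \<longleftrightarrow> internal_node t p \<and> card {q \<in> neighbors t p. leaf_node t q} = 2"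

definition thin :: "'a tree \<Rightarrow> bool" where
  "thin t \<longleftrightarrow> (\<exists>!p. impasse t p)"

section \<open>The merge tree induced by a critical discrete Morse function\<close>

definition sublevel :: "'a graph \<Rightarrow> ('a set \<Rightarrow> real) \<Rightarrow> real \<Rightarrow> 'a graph" where
  "sublevel G f c = \<lparr>verts = {v \<in> verts G. f {v} < c}, edges = {e \<in> edges G. f e < c}\<rparr>"

definition adjacency :: "'a graph \<Rightarrow> ('a \<times> 'a) set" where
  "adjacency G = {(x, y). {x, y} \<in> edges G}"

definition component :: "'a graph \<Rightarrow> 'a \<Rightarrow> 'a graph" where
  "component G w =
    (let C = {x \<in> verts G. (w, x) \<in> (adjacency G)\<^sup>*}
     in \<lparr>verts = C, edges = {e \<in> edges G. e \<subseteq> C}\<rparr>)"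

definition values_below :: "'a graph \<Rightarrow> ('a set \<Rightarrow> real) \<Rightarrow> real \<Rightarrow> 'a \<Rightarrow> real set" where
  "values_below G f c w = f ` simplices (component (sublevel G f c) w)"

text \<open>\<open>merge_subtree G f d c t\<close>: \<open>t\<close> is the labeled subtree that the construction grows from
  a node with direction \<open>d\<close> and label \<open>c\<close>. In the second rule \<open>u\<close> names the endpoint whose
  component has the smaller minimum; as \<open>{u, v} = {v, u}\<close>, this covers both cases.\<close>

inductive merge_subtree ::
  "'a graph \<Rightarrow> ('a set \<Rightarrow> real) \<Rightarrow> direction \<Rightarrow> real \<Rightarrow> real tree \<Rightarrow> bool"
  for G :: "'a graph" and f :: "'a set \<Rightarrow> real" where
  vertex: "v \<in> verts G \<Longrightarrow> f {v} = c \<Longrightarrow> merge_subtree G f d c (Node Leaf c Leaf)"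
| edge: "{u, v} \<in> edges G \<Longrightarrow> f {u, v} = c \<Longrightarrow>
    Min (values_below G f c u) < Min (values_below G f c v) \<Longrightarrow>
    merge_subtree G f d (Max (values_below G f c u)) tu \<Longrightarrow>
    merge_subtree G f (opposite d) (Max (values_below G f c v)) tv \<Longrightarrow>
    merge_subtree G f d c (case d of L \<Rightarrow> Node tu c tv | R \<Rightarrow> Node tv c tu)"

definition induced_merge_tree :: "'a graph \<Rightarrow> ('a set \<Rightarrow> real) \<Rightarrow> real tree \<Rightarrow> bool" where
  "induced_merge_tree G f t \<longleftrightarrow> merge_subtree G f L (Max (f ` simplices G)) t"

lemma star_graph_simple:
  assumes "star_graph G"
  shows "simple_graph G"
proof -
  from assms obtain k where "complete_bipartite 1 k G"
    unfolding star_graph_def by blast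
  then obtain A B where *: "finite A" "finite B" "A \<inter> B = {}"
    "verts G = A \<union> B" "edges G = {{a, b} | a b. a \<in> A \<and> b \<in> B}"
    unfolding complete_bipartite_def by (elim exE conjE, intro that)
  have "e \<subseteq> verts G \<and> card e = 2" if "e \<in> edges G" for e
  proof -
    from that *(5) obtain a b where "e = {a, b}" "a \<in> A" "b \<in> B" by blast
    moreover from this *(3) have "a \<noteq> b" by blast
    ultimately show ?thesis using *(4) by simp
  qed
  then show ?thesis
    unfolding simple_graph_def using *(1,2,4) by simp
qed

lemma critical_discrete_morse_inj:
  assumes "critical_discrete_morse G f"
  shows "inj_on f (simplices G)"
proof (rule inj_onI)
  fix \<sigma> \<tau> assume *: "\<sigma> \<in> simplices G" "\<tau> \<in> simplices G" "f \<sigma> = f \<tau>"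
  from assms *(1) have "critical_simplex G f \<sigma>"
    by (simp add: critical_discrete_morse_def)
  then have "f \<tau> \<noteq> f \<sigma>" if "\<tau> \<noteq> \<sigma>"
    using *(2) that unfolding critical_simplex_def by blast
  with *(3) show "\<sigma> = \<tau>" by metis
qed

text \<open>The construction yields at most one tree, so \<^const>\<open>induced_merge_tree\<close> determines
  \<open>M\<^sub>f\<close>.\<close>

lemma merge_subtree_unique:
  assumes G: "simple_graph G" and inj: "inj_on f (simplices G)"
    and "merge_subtree G f d c t" "merge_subtree G f d c t'"
  shows "t = t'"
proof -
  have clash: "f {v} \<noteq> f {x, y}" if "v \<in> verts G" "{x, y} \<in> edges G" for v x y
  proof
    assume "f {v} = f {x, y}"
    then have "{v} = {x, y}"
      using inj_onD[OF inj, of "{v}" "{x, y}"] that by (simp add: simplices_def)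
    moreover have "card {x, y} = 2"
      using G that(2) by (simp add: simple_graph_def)
    ultimately have "card {v} = 2" by simp
    then show False by simp
  qed
  show ?thesis
    using assms(3,4)
  proof (induction arbitrary: t' rule: merge_subtree.induct)
    case (vertex v c d)
    from vertex(3) show ?case
    proof cases
      case (edge x y tu tv)
      with clash[OF vertex(1) edge(2)] vertex(2) show ?thesis by simp
    qed simp
  next
    case (edge u v c d tu tv)
    from edge.prems show ?case
    proof cases
      case (vertex w)
      with clash[OF vertex(2) edge.hyps(1)] edge.hyps(2) show ?thesis by simp
    next
      case e: (edge x y su sv)
      have "{x, y} = {u, v}"
        using inj_onD[OF inj, of "{x, y}" "{u, v}"] e(2,3) edge.hyps(1,2)
        by (simp add: simplices_def)
      then consider "x = u" "y = v" | "x = v" "y = u"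
        unfolding doubleton_eq_iff by blast
      then show ?thesis
      proof cases
        case 1
        then have "tu = su" "tv = sv"
          using edge.IH(1)[of su] edge.IH(2)[of sv] e(5,6) by simp_all
        with e(1) show ?thesis by (simp only:)
      next
        case 2
        with e(4) edge.hyps(3) show ?thesis by simp
      qed
    qed
  qed
qed

lemma induced_merge_tree_unique:
  assumes "simple_graph G" "critical_discrete_morse G f"
    and "induced_merge_tree G f t" "induced_merge_tree G f t'"
  shows "t = t'"
  using merge_subtree_unique[OF assms(1) critical_discrete_morse_inj[OF assms(2)]
      assms(3,4)[unfolded induced_merge_tree_def]] .

end

theory Submission imports Defs begin

text \<open>In a full binary tree every internal node has an impasse at or below it, so in a thin merge
  tree at most one child of each node is internal: the internal nodes form a path from the root.
  Number the nodes of this path, extended by a leaf below the impasse, as \<open>n, \<dots>, 0\<close> from the root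
  downwards. On the star with center \<open>0\<close> and outer vertices \<open>1, \<dots>, n\<close> let \<open>f {0} = 0\<close> and
  \<open>f {0, j} = j\<close>, and let \<open>f {j}\<close> be either \<open>j - 1/2\<close> or \<open>- j\<close>. Removing the edge \<open>{0, j}\<close> splits the
  sublevel component into the star on \<open>{0, \<dots>, j - 1}\<close>, whose maximum is \<open>j - 1\<close>, and the vertex \<open>j\<close>.
  In the first case the minimum lies in the star, in the second it is \<open>f {j}\<close>, so the side on which
  the path continues can be prescribed for each \<open>j\<close> separately.\<close>

section \<open>Thin full binary trees\<close>

abbreviation single :: "'a tree \<Rightarrow> bool" where
  "single t \<equiv> \<exists>x. t = Node Leaf x Leaf"

text \<open>Whether a node is an impasse depends on neighbor counts, and these include the parent.
  This condition looks only downwards, so it transfers between a tree and its subtrees.\<close>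

definition cherry :: "'a tree \<Rightarrow> direction list \<Rightarrow> bool" where
  "cherry t p \<longleftrightarrow> (\<forall>d. p @ [d] \<in> nodes_of t) \<and> (\<forall>d d'. p @ [d, d'] \<notin> nodes_of t)"

lemma finite_nodes_of: "finite (nodes_of t)"
  by (induction t) auto

lemma nodes_of_prefix: "p @ q \<in> nodes_of t \<Longrightarrow> p \<in> nodes_of t"
proof (induction t arbitrary: p)
  case (Node l x r)
  then show ?case by (cases p) auto
qed simp

lemma Nil_in_nodes_of_iff: "[] \<in> nodes_of t \<longleftrightarrow> t \<noteq> Leaf"
  by (cases t) auto

lemma children_Node:
  "children (Node l x r) (L # p) = (#) L ` children l p"
  "children (Node l x r) (R # p) = (#) R ` children r p"
  by (auto simp: children_def)

lemma card_image_Cons: "card ((#) d ` A) = card A"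
  by (simp add: card_image)

lemma full_NodeD:
  assumes "full (Node l x r)"
  shows "full l" "full r" "l = Leaf \<longleftrightarrow> r = Leaf"
proof -
  have *: "card (children (Node l x r) p) = 0 \<or> card (children (Node l x r) p) = 2"
    if "p \<in> nodes_of (Node l x r)" for p
    using assms that by (auto simp: full_def)
  show "full l" unfolding full_def
  proof
    fix p assume "p \<in> nodes_of l"
    then show "card (children l p) = 0 \<or> card (children l p) = 2"
      using *[of "L # p"] by (simp add: children_Node card_image_Cons)
  qed
  show "full r" unfolding full_def
  proof
    fix p assume "p \<in> nodes_of r"
    then show "card (children r p) = 0 \<or> card (children r p) = 2"
      using *[of "R # p"] by (simp add: children_Node card_image_Cons)
  qed
  have "children (Node l x r) [] =
      (if l = Leaf then {} else {[L]}) \<union> (if r = Leaf then {} else {[R]})"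
    by (auto simp: children_def Nil_in_nodes_of_iff image_iff)
  then show "l = Leaf \<longleftrightarrow> r = Leaf"
    using *[of "[]"] by (auto split: if_splits)
qed

lemma full_siblings:
  assumes "full t" "p @ [d] \<in> nodes_of t"
  shows "p @ [d'] \<in> nodes_of t"
proof -
  have p: "p \<in> nodes_of t" using assms(2) by (rule nodes_of_prefix)
  have sub: "children t p \<subseteq> {p @ [d], p @ [opposite d]}"
    unfolding children_def by (cases d) (auto, (metis direction.exhaust)+)
  have "p @ [d] \<in> children t p" using assms(2) by (simp add: children_def)
  then have "card (children t p) \<noteq> 0"
    using finite_subset[OF sub] by (metis card_eq_0_iff empty_iff finite.emptyI finite_insert)
  then have "card (children t p) = 2"
    using assms(1) p by (auto simp: full_def)
  then have "children t p = {p @ [d], p @ [opposite d]}"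
    using sub by (intro card_seteq) (auto simp: card_insert_if)
  then show ?thesis
    unfolding children_def by (cases d; cases d') auto
qed

lemma cherry_imp_impasse:
  assumes "full t" "cherry t p"
  shows "impasse t p"
proof -
  have d: "p @ [d] \<in> nodes_of t" and dd: "p @ [d, d'] \<notin> nodes_of t" for d d'
    using assms(2) by (auto simp: cherry_def)
  have p: "p \<in> nodes_of t" using d[of L] by (rule nodes_of_prefix)
  have card_ge_2: "card (neighbors t q) \<ge> 2" if "{q @ [L], q @ [R]} \<subseteq> neighbors t q" for q
  proof -
    have "finite (neighbors t q)" by (simp add: neighbors_def finite_nodes_of)
    from card_mono[OF this that] show ?thesis by simp
  qed
  have two: "p @ [L] \<noteq> p @ [R]" by simp
  have "{p @ [L], p @ [R]} \<subseteq> neighbors t p"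
    using d by (auto simp: neighbors_def children_def)
  then have "card (neighbors t p) \<ge> 2"
    by (rule card_ge_2)
  then have "internal_node t p" using p by (simp add: internal_node_def)
  moreover have "{q \<in> neighbors t p. leaf_node t q} = {p @ [L], p @ [R]}"
  proof
    show "{p @ [L], p @ [R]} \<subseteq> {q \<in> neighbors t p. leaf_node t q}"
    proof -
      have "neighbors t (p @ [d]) = {p}" for d
        using p dd d by (auto simp: neighbors_def children_def)
      then have "leaf_node t (p @ [d])" for d
        using d by (simp add: leaf_node_def)
      then show ?thesis using d by (auto simp: neighbors_def children_def)
    qed
    show "{q \<in> neighbors t p. leaf_node t q} \<subseteq> {p @ [L], p @ [R]}"
    proof
      fix q assume q: "q \<in> {q \<in> neighbors t p. leaf_node t q}"
      \<comment> \<open>The parent of \<open>p\<close>, if any, has both children by fullness, hence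
        at least two neighbors, so it does not count as a leaf next to \<open>p\<close>.\<close>
      have "\<nexists>d. p = q @ [d]"
      proof
        assume "\<exists>d. p = q @ [d]"
        then have "q @ [d] \<in> nodes_of t" for d
          using p full_siblings[OF assms(1)] by blast
        then have "{q @ [L], q @ [R]} \<subseteq> neighbors t q"
          using q by (auto simp: neighbors_def children_def)
        then have "card (neighbors t q) \<ge> 2"
          by (rule card_ge_2)
        then show False using q by (simp add: leaf_node_def)
      qed
      then obtain d where "q = p @ [d]"
        using q by (auto simp: neighbors_def children_def)
      then show "q \<in> {p @ [L], p @ [R]}" by (cases d) auto
    qed
  qed
  ultimately show ?thesis using two by (simp add: impasse_def)
qed

lemma cherry_Node:
  "cherry (Node l x r) (L # p) \<longleftrightarrow> cherry l p"
  "cherry (Node l x r) (R # p) \<longleftrightarrow> cherry r p"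
  by (simp_all add: cherry_def image_iff)

text \<open>If both children are single, the root itself is a cherry; otherwise one descends into a
  child that is not single.\<close>

lemma cherry_exists:
  "full t \<Longrightarrow> t \<noteq> Leaf \<Longrightarrow> \<not> single t \<Longrightarrow> \<exists>p. cherry t p"
proof (induction t)
  case (Node l x r)
  note full = full_NodeD[OF Node.prems(1)]
  have ne: "l \<noteq> Leaf" "r \<noteq> Leaf" using full(3) Node.prems(3) by auto
  show ?case
  proof (cases "single l \<and> single r")
    case True
    then have "p \<in> nodes_of (Node l x r) \<longleftrightarrow> p \<in> {[], [L], [R]}" for p by auto
    then have "cherry (Node l x r) []"
      unfolding cherry_def by (simp del: nodes_of.simps) (metis direction.exhaust)
    then show ?thesis ..
  next
    case False
    then show ?thesis using Node.IH full ne cherry_Node[of l x r] by metis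
  qed
qed simp

lemma thin_cherry_unique:
  assumes "full t" "thin t" "cherry t p" "cherry t q"
  shows "p = q"
  using assms cherry_imp_impasse unfolding thin_def by blast

section \<open>The discrete Morse function on the star\<close>

definition star :: "nat \<Rightarrow> nat graph" where
  "star n = \<lparr>verts = {..n}, edges = {{0, j} | j. j \<in> {1..n}}\<rparr>"

text \<open>\<open>Max s\<close> reads off the index j from both {j} and {0, j}, and
  \<open>0 \<in> s\<close> separates the center and the edges from the outer vertices.\<close>

definition star_morse :: "(nat \<Rightarrow> bool) \<Rightarrow> nat set \<Rightarrow> real" where
  "star_morse up s = (if 0 \<in> s then real (Max s)
     else if up (Max s) then real (Max s) - 1 / 2 else - real (Max s))"

lemma star_graph_star: "n \<ge> 1 \<Longrightarrow> star_graph (star n)"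
proof -
  have "complete_bipartite 1 n (star n)"
    unfolding complete_bipartite_def
    by (rule exI[of _ "{0}"], rule exI[of _ "{1..n}"]) (auto simp: star_def)
  then show "n \<ge> 1 \<Longrightarrow> star_graph (star n)"
    unfolding star_graph_def by blast
qed

lemma simplices_star:
  "simplices (star n) = (\<lambda>j. {j}) ` {..n} \<union> (\<lambda>j. {0, j}) ` {1..n}"
  by (auto simp: simplices_def star_def)

lemma star_morse_values [simp]:
  "star_morse up {0} = 0"
  "star_morse up {0, j} = real j"
  "j > 0 \<Longrightarrow> star_morse up {j} = (if up j then real j - 1 / 2 else - real j)"
  by (auto simp: star_morse_def)

lemma star_morse_vertex_less: "j > 0 \<Longrightarrow> star_morse up {j} < real j"
  by simp

lemma star_morse_vertex_le: "star_morse up {j} \<le> real j"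
  by (cases "j = 0") auto

lemma half_integer_neq: "real i \<noteq> real j - 1 / 2"
proof -
  have "2 * i + 1 \<noteq> 2 * j" by presburger
  then have "2 * real i + 1 \<noteq> 2 * real j" by linarith
  then show ?thesis by auto
qed

text \<open>The center and the edges take nonnegative integers, the outer vertices half-integers or
  negative integers, and within each of these kinds the value determines the index.\<close>

lemma inj_on_star_morse: "inj_on (star_morse up) (simplices (star n))"
proof -
  have v: "i = j" if "star_morse up {i} = star_morse up {j}" for i j
  proof -
    have "real k * 2 \<noteq> 1" for k using half_integer_neq[of 0 k] by linarith
    then show ?thesis using that
      by (cases "i = 0"; cases "j = 0") (auto split: if_splits)
  qed
  have e: "star_morse up {i} \<noteq> real j" if "j \<ge> 1" for i j
    using that half_integer_neq[of j i] by (cases "i = 0") auto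
  have e': "real j \<noteq> star_morse up {i}" if "j \<ge> 1" for i j
    using e[OF that] by metis
  show ?thesis
    unfolding simplices_star inj_on_def
    by (auto simp: e e' simp del: star_morse_values(1,3) dest: v)
qed

lemma critical_discrete_morse_star_morse:
  "critical_discrete_morse (star n) (star_morse up)"
proof -
  let ?f = "star_morse up" and ?S = "simplices (star n)"
  have inj: "\<sigma> = \<tau>" if "\<sigma> \<in> ?S" "\<tau> \<in> ?S" "?f \<sigma> = ?f \<tau>" for \<sigma> \<tau>
    using inj_onD[OF inj_on_star_morse that(3,1,2)] .
  have "card {\<sigma> \<in> ?S. ?f \<sigma> = y} \<le> 2" for y
  proof -
    have "card {\<sigma> \<in> ?S. ?f \<sigma> = y} \<le> Suc 0"
    proof (subst card_le_Suc0_iff_eq)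
      show "finite {\<sigma> \<in> ?S. ?f \<sigma> = y}" by (simp add: simplices_star)
      show "\<forall>\<sigma>\<in>{\<sigma> \<in> ?S. ?f \<sigma> = y}. \<forall>\<tau>\<in>{\<sigma> \<in> ?S. ?f \<sigma> = y}. \<sigma> = \<tau>"
        using inj by blast
    qed
    then show ?thesis by simp
  qed
  moreover have "?f {v} \<le> ?f e" if "e \<in> edges (star n)" "v \<in> e" for e v
    using that star_morse_vertex_le[of up v] by (auto simp: star_def)
  ultimately have "discrete_morse (star n) ?f"
    unfolding discrete_morse_def using inj by blast
  then show ?thesis
    unfolding critical_discrete_morse_def critical_simplex_def using inj by blast
qed

text \<open>This labels the root, and also every smaller star cut off later; for n = 0 that star is
  the lone center with value 0.\<close>

lemma Max_star_morse: "Max (star_morse up ` simplices (star n)) = real n"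
proof (rule Max_eqI)
  show "finite (star_morse up ` simplices (star n))" by (simp add: simplices_star)
  have "star_morse up {j} \<le> real n" if "j \<le> n" for j
    using star_morse_vertex_le[of up j] that by linarith
  then show "y \<le> real n" if "y \<in> star_morse up ` simplices (star n)" for y
    using that by (auto simp: simplices_star simp del: star_morse_values(1,3))
  show "real n \<in> star_morse up ` simplices (star n)"
  proof (cases "n = 0")
    case False
    then have "{0, n} \<in> simplices (star n)" by (auto simp: simplices_star)
    from imageI[OF this, of "star_morse up"] show ?thesis by simp
  qed (auto simp: simplices_star)
qed

text \<open>The center already contributes 0, which is below i + 1/2, while every value on the star
  is at least - i and hence above - (i + 1).\<close>

lemma Min_star_morse_less_iff:
  "Min (star_morse up ` simplices (star i)) < star_morse up {Suc i} \<longleftrightarrow> up (Suc i)"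
  "star_morse up {Suc i} < Min (star_morse up ` simplices (star i)) \<longleftrightarrow> \<not> up (Suc i)"
proof -
  let ?V = "star_morse up ` simplices (star i)"
  have fin: "finite ?V" "?V \<noteq> {}" by (auto simp: simplices_star)
  have "{0} \<in> simplices (star i)" by (auto simp: simplices_star)
  from imageI[OF this, of "star_morse up"] have z: "0 \<in> ?V" by simp
  have "star_morse up {j} \<ge> - real i" if "j \<le> i" for j
    using that by (cases "j = 0") auto
  then have lower: "y \<ge> - real i" if "y \<in> ?V" for y
    using that by (auto simp: simplices_star simp del: star_morse_values(1,3))
  have up: "Min ?V < star_morse up {Suc i}" if "up (Suc i)"
    using Min_le[OF fin(1) z] that by simp
  have down: "star_morse up {Suc i} < Min ?V" if "\<not> up (Suc i)"
    using lower[OF Min_in[OF fin]] that by simp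
  show "Min ?V < star_morse up {Suc i} \<longleftrightarrow> up (Suc i)"
       "star_morse up {Suc i} < Min ?V \<longleftrightarrow> \<not> up (Suc i)"
    using up down by fastforce+
qed

section \<open>Components of the sublevel graphs of the star\<close>

lemma sublevel_star:
  assumes "i < n"
  shows "edges (sublevel (star n) (star_morse up) (real (Suc i))) = edges (star i)"
    and "{..Suc i} \<subseteq> verts (sublevel (star n) (star_morse up) (real (Suc i)))"
proof -
  show "edges (sublevel (star n) (star_morse up) (real (Suc i))) = edges (star i)"
    using assms by (auto simp: sublevel_def star_def)
  have "star_morse up {j} < real (Suc i)" if "j \<le> Suc i" for j
  proof (cases "j = 0")
    case False
    then show ?thesis using star_morse_vertex_less[of j up] that by linarith
  qed simp
  \<comment> \<open>Equality can fail: an outer vertex j > i + 1 with value - j is already present.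
    It is isolated, since its edge has value j, and so does not affect the two components
    below.\<close>
  then show "{..Suc i} \<subseteq> verts (sublevel (star n) (star_morse up) (real (Suc i)))"
    using assms by (auto simp: sublevel_def star_def simp del: star_morse_values)
qed

lemma component_sublevel_center:
  assumes "i < n"
  shows "component (sublevel (star n) (star_morse up) (real (Suc i))) 0 = star i"
proof -
  let ?H = "sublevel (star n) (star_morse up) (real (Suc i))"
  have adj: "(x, y) \<in> adjacency ?H \<longleftrightarrow> {x, y} \<in> edges (star i)" for x y
    by (simp only: adjacency_def sublevel_star(1)[OF assms] mem_Collect_eq case_prod_conv)
  \<comment> \<open>The last edge of a path to y lies in \<open>star i\<close>, which already bounds
    y.\<close>
  have "y \<le> i" if "(0, y) \<in> (adjacency ?H)\<^sup>*" for y
    using that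
  proof cases
    case (step z)
    then show ?thesis unfolding adj by (auto simp: star_def doubleton_eq_iff)
  qed simp
  moreover have "(0, y) \<in> (adjacency ?H)\<^sup>*" if "y \<le> i" for y
  proof (cases "y = 0")
    case False
    then have "(0, y) \<in> adjacency ?H" unfolding adj using that by (auto simp: star_def)
    then show ?thesis ..
  qed simp
  ultimately have C: "{x \<in> verts ?H. (0, x) \<in> (adjacency ?H)\<^sup>*} = {..i}"
    using sublevel_star(2)[OF assms, of up] by (auto simp: subset_iff)
  show ?thesis
    unfolding component_def Let_def C sublevel_star(1)[OF assms] by (auto simp: star_def)
qed

lemma component_sublevel_outer:
  assumes "i < n"
  shows "component (sublevel (star n) (star_morse up) (real (Suc i))) (Suc i)
    = \<lparr>verts = {Suc i}, edges = {}\<rparr>"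
proof -
  let ?H = "sublevel (star n) (star_morse up) (real (Suc i))"
  have "(Suc i, y) \<notin> adjacency ?H" for y
    unfolding adjacency_def mem_Collect_eq case_prod_conv sublevel_star(1)[OF assms]
    by (auto simp: star_def doubleton_eq_iff)
  then have "y = Suc i" if "(Suc i, y) \<in> (adjacency ?H)\<^sup>*" for y
    using that by (auto elim: converse_rtranclE)
  then have C: "{x \<in> verts ?H. (Suc i, x) \<in> (adjacency ?H)\<^sup>*} = {Suc i}"
    using sublevel_star(2)[OF assms, of up] by auto
  show ?thesis
    unfolding component_def Let_def C sublevel_star(1)[OF assms] by (auto simp: star_def)
qed

section \<open>The induced merge tree\<close>

text \<open>The child carrying the path keeps direction \<open>d\<close> exactly when its star has
  the smaller minimum, that is, when \<open>up (Suc i)\<close>. So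
  \<open>(d = L) = up (Suc i)\<close> says that this child is the left one.\<close>

fun caterpillar :: "(nat \<Rightarrow> bool) \<Rightarrow> direction \<Rightarrow> nat \<Rightarrow> real tree" where
  "caterpillar up d 0 = Node Leaf 0 Leaf"
| "caterpillar up d (Suc i) =
    (let s = caterpillar up (if up (Suc i) then d else opposite d) i;
         l = Node Leaf (star_morse up {Suc i}) Leaf
     in if (d = L) = up (Suc i) then Node s (real (Suc i)) l else Node l (real (Suc i)) s)"

lemma merge_subtree_star:
  "i \<le> n \<Longrightarrow> merge_subtree (star n) (star_morse up) d (real i) (caterpillar up d i)"
proof (induction i arbitrary: d)
  case 0
  show ?case by (auto simp: star_def intro!: merge_subtree.vertex[where v = 0])
next
  case (Suc i)
  let ?G = "star n" and ?f = "star_morse up"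
  let ?l = "Node Leaf (?f {Suc i}) Leaf"
  have i: "i < n" using Suc.prems by simp
  have vals: "values_below ?G ?f (real (Suc i)) 0 = ?f ` simplices (star i)"
      "values_below ?G ?f (real (Suc i)) (Suc i) = {?f {Suc i}}"
    unfolding values_below_def component_sublevel_center[OF i] component_sublevel_outer[OF i]
    by (simp_all add: simplices_def del: star_morse_values)
  have E: "{0, Suc i} \<in> edges ?G" using i by (auto simp: star_def)
  \<comment> \<open>The edge rule names the endpoint with the smaller minimum first; without
    \<open>up (Suc i)\<close> this is the outer vertex.\<close>
  then have E': "{Suc i, 0} \<in> edges ?G" by (simp add: insert_commute)
  have fE': "?f {Suc i, 0} = real (Suc i)" by (simp add: insert_commute)
  have sub: "merge_subtree ?G ?f d' (real i) (caterpillar up d' i)" for d'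
    using Suc by simp
  have leaf: "merge_subtree ?G ?f d' (?f {Suc i}) ?l" for d'
    using i by (intro merge_subtree.vertex[where v = "Suc i"]) (simp_all add: star_def)
  show ?case
  proof (cases "up (Suc i)")
    case True
    have "merge_subtree ?G ?f d (real (Suc i))
      (case d of L \<Rightarrow> Node (caterpillar up d i) (real (Suc i)) ?l
        | R \<Rightarrow> Node ?l (real (Suc i)) (caterpillar up d i))"
      using True sub leaf
      by (intro merge_subtree.edge[where f = ?f, OF E star_morse_values(2)])
        (simp_all only: vals Max_star_morse Min_star_morse_less_iff Min_singleton Max_singleton)
    then show ?thesis using True by (cases d) (simp_all add: Let_def)
  next
    case False
    have "merge_subtree ?G ?f d (real (Suc i))
      (case d of L \<Rightarrow> Node ?l (real (Suc i)) (caterpillar up (opposite d) i)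
        | R \<Rightarrow> Node (caterpillar up (opposite d) i) (real (Suc i)) ?l)"
      using False sub leaf
      by (intro merge_subtree.edge[where f = ?f, OF E' fE'])
        (simp_all only: vals Max_star_morse Min_star_morse_less_iff Min_singleton Max_singleton
          not_False_eq_True)
    then show ?thesis using False by (cases d) (simp_all add: Let_def)
  qed
qed

section \<open>Thin trees as caterpillars\<close>

lemma caterpillar_cong:
  "(\<And>j. j \<le> i \<Longrightarrow> up j = up' j) \<Longrightarrow> caterpillar up d i = caterpillar up' d i"
  by (induction i arbitrary: d) (simp_all add: Let_def)

lemma unlabeled_simps:
  "unlabeled Leaf = Leaf"
  "unlabeled (Node l x r) = Node (unlabeled l) () (unlabeled r)"
  by (simp_all add: unlabeled_def)

text \<open>The caterpillar of height n does not read \<open>up (Suc n)\<close>, so this value is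
  free to select the side of the new leaf.\<close>

lemma extend_caterpillar:
  assumes "unlabeled (caterpillar up (if b then d else opposite d) n) = s"
  shows "\<exists>up'. unlabeled (caterpillar up' d (Suc n)) =
    (if (d = L) = b then Node s () (Node Leaf () Leaf) else Node (Node Leaf () Leaf) () s)"
proof -
  let ?up = "up(Suc n := b)"
  have "caterpillar ?up d' n = caterpillar up d' n" for d'
    by (rule caterpillar_cong) simp
  then have "unlabeled (caterpillar ?up d (Suc n)) =
    (if (d = L) = b then Node s () (Node Leaf () Leaf) else Node (Node Leaf () Leaf) () s)"
    using assms by (simp add: Let_def unlabeled_simps)
  then show ?thesis by (rule exI[where x = ?up])
qed

text \<open>Having at most one cherry is inherited by both children and also covers a single node,
  which has none. The direction stays arbitrary because it may change along the path.\<close>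

lemma ex_caterpillar:
  fixes t :: binary_tree
  assumes "full t" "t \<noteq> Leaf" "\<And>p q. cherry t p \<Longrightarrow> cherry t q \<Longrightarrow> p = q"
  shows "\<exists>n up. unlabeled (caterpillar up d n) = t"
  using assms
proof (induction t arbitrary: d)
  case (Node l x r)
  note full = full_NodeD[OF Node.prems(1)]
  have uniq: "p = q" if "cherry (Node l x r) p" "cherry (Node l x r) q" for p q
    using Node.prems(3) that .
  have l: "p = q" if "cherry l p" "cherry l q" for p q
    using uniq[of "L # p" "L # q"] that by (simp add: cherry_Node)
  have r: "p = q" if "cherry r p" "cherry r q" for p q
    using uniq[of "R # p" "R # q"] that by (simp add: cherry_Node)
  consider "l = Leaf" "r = Leaf" | "l \<noteq> Leaf" "single r" | "r \<noteq> Leaf" "single l"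
  proof -
    \<comment> \<open>Two children that are not single would yield cherries whose addresses start
      with \<open>L\<close> and with \<open>R\<close>.\<close>
    have "single l \<or> single r" if ne: "l \<noteq> Leaf" "r \<noteq> Leaf"
    proof (rule ccontr)
      assume "\<not> (single l \<or> single r)"
      then obtain p q where "cherry l p" "cherry r q"
        using cherry_exists[OF full(1) ne(1)] cherry_exists[OF full(2) ne(2)] by blast
      then show False using uniq[of "L # p" "R # q"] by (simp add: cherry_Node)
    qed
    then show ?thesis using full(3) that by blast
  qed
  then show ?case
  proof cases
    case 1
    then have "unlabeled (caterpillar up d 0) = Node l x r" for up
      by (simp add: unlabeled_simps)
    then show ?thesis by blast
  next
    case 2
    \<comment> \<open>With \<open>d = L\<close> as the new value of \<open>up\<close>, the path
      continues to the left, and the direction handed down is \<open>L\<close> for either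
      \<open>d\<close>. The next case mirrors this with \<open>d = R\<close>.\<close>
    obtain n up where "unlabeled (caterpillar up (if d = L then d else opposite d) n) = l"
      using Node.IH(1)[OF full(1) 2(1) l] by blast
    from extend_caterpillar[OF this]
    have "\<exists>up'. unlabeled (caterpillar up' d (Suc n)) = Node l x r" using 2(2) by auto
    then show ?thesis by blast
  next
    case 3
    obtain n up where "unlabeled (caterpillar up (if d = R then d else opposite d) n) = r"
      using Node.IH(2)[OF full(2) 3(1) r] by blast
    from extend_caterpillar[OF this]
    have "\<exists>up'. unlabeled (caterpillar up' d (Suc n)) = Node l x r"
      using 3(2) by (cases d) auto
    then show ?thesis by blast
  qed
qed simp

lemma not_thin_single: "\<not> thin (Node Leaf x Leaf)"
proof -
  have "neighbors (Node Leaf x Leaf) p = {}" for p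
    by (auto simp: neighbors_def children_def)
  then have "\<not> impasse (Node Leaf x Leaf) p" for p
    by (simp add: impasse_def internal_node_def)
  then show ?thesis unfolding thin_def by blast
qed

theorem proposition22:
  fixes M :: binary_tree
  assumes "merge_tree M" and "thin M"
  shows "\<exists>(S :: nat graph) (f :: nat set \<Rightarrow> real) (M\<^sub>f :: real tree).
           star_graph S \<and> critical_discrete_morse S f \<and>
           induced_merge_tree S f M\<^sub>f \<and> unlabeled M\<^sub>f = M"
proof -
  have M: "full M" "M \<noteq> Leaf" using assms(1) by (auto simp: merge_tree_def)
  obtain n up where n: "unlabeled (caterpillar up L n) = M"
    using ex_caterpillar[OF M thin_cherry_unique[OF M(1) assms(2)]] by blast
  \<comment> \<open>For n = 0 the graph would have no edge and not be a star; its tree is a single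
    node, which has no impasse.\<close>
  have "n \<noteq> 0"
  proof
    assume "n = 0"
    then have "M = Node Leaf () Leaf" using n by (simp add: unlabeled_simps)
    then show False using assms(2) by (simp add: not_thin_single)
  qed
  then have "star_graph (star n)" by (intro star_graph_star) simp
  moreover have "induced_merge_tree (star n) (star_morse up) (caterpillar up L n)"
    unfolding induced_merge_tree_def Max_star_morse by (rule merge_subtree_star) simp
  ultimately show ?thesis
    using critical_discrete_morse_star_morse n by blast
qed

end
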